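(* Let $n\in\mathbb N_0$ and $x\in(-1,1)$. Then $$\lim_{\lambda\to+\infty}\frac{2^{\lambda}\,\Gamma(\lambda+1)\,(2\lambda+1)_n}{(\lambda+\frac12)^{\frac n2}\left(1-\frac{x^2}{\lambda+\frac12}\right)^{\frac{\lambda}{2}}}\,{\sf P}_{n+\lambda}^{-\lambda}\left(x\,(\lambda+\tfrac12)^{-\frac12}\right)=H_n(x).$$
   Context: $\mathbb N_0=\{0,1,2,\ldots\}$; $(a)_0=1$, $(a)_n=a(a+1)\cdots(a+n-1)$. $H_n$ denotes the (physicists') Hermite polynomial of degree $n$, $H_n(x)=(2x)^n\,{}_2F_0\left(-\frac n2,\frac{1-n}{2};-;-\frac{1}{x^2}\right)=n!\sum_{j=0}^{\lfloor n/2\rfloor}\frac{(-1)^j(2x)^{n-2j}}{j!\,(n-2j)!}$. The Ferrers function of the first kind is, for $y\in(-1,1)$, $${\sf P}_\nu^{-\mu}(y)=\frac{1}{\Gamma(\mu+1)}\left(\frac{1-y}{1+y}\right)^{\frac{\mu}{2}}{}_2F_1\left(-\nu,\nu+1;\mu+1;\frac{1-y}{2}\right).$$ The limit is over real $\lambda$. *)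

theory Defs
  imports "HOL-Analysis.Analysis"
begin

text \<open>
  The Gauss series. With numerator parameters \<open>a, b\<close>, denominator parameter \<open>c\<close> and scale \<open>1\<close>,
  the \<open>k\<close>-th coefficient of \<^const>\<open>fps_hypergeo\<close> is \<open>(a)\<^sub>k (b)\<^sub>k / ((c)\<^sub>k k!)\<close>.
  No analytic continuation is made, so this is the usual function only for \<open>\<bar>z\<bar> < 1\<close>
  (and \<open>c\<close> not in \<open>{0, -1, -2, \<dots>}\<close>).
\<close>

definition hyp2F1 :: "real \<Rightarrow> real \<Rightarrow> real \<Rightarrow> real \<Rightarrow> real" where
  "hyp2F1 a b c z = eval_fps (fps_hypergeo [a, b] [c] 1) z"

text \<open>
  \<open>ferrers_P \<nu> \<mu> y\<close> is the Ferrers function of the first kind of degree \<open>\<nu>\<close> and order \<open>-\<mu>\<close>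
  (note the sign of the order). It is meaningful for \<open>-1 < y < 1\<close>, where \<open>(1 - y) / 2\<close> lies in
  \<open>(0, 1)\<close> and the series converges, and for \<open>\<mu>\<close> not a negative integer.
\<close>

definition ferrers_P :: "real \<Rightarrow> real \<Rightarrow> real \<Rightarrow> real" where
  "ferrers_P \<nu> \<mu> y =
     1 / Gamma (\<mu> + 1) * ((1 - y) / (1 + y)) powr (\<mu> / 2) *
       hyp2F1 (- \<nu>) (\<nu> + 1) (\<mu> + 1) ((1 - y) / 2)"

text \<open>
  The physicists' Hermite polynomials, by their explicit finite sum; unlike the form
  \<open>(2x)\<^sup>n \<^sub>2F\<^sub>0(-n/2, (1-n)/2; -; -1/x\<^sup>2)\<close>, this also covers \<open>x = 0\<close>.
\<close>

definition hermite :: "nat \<Rightarrow> real \<Rightarrow> real" where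
  "hermite n x =
     fact n * (\<Sum>j\<le>n div 2. (-1) ^ j * (2 * x) ^ (n - 2 * j) / (fact j * fact (n - 2 * j)))"

end

theory Submission
  imports Defs "HOL-Real_Asymp.Real_Asymp"
begin

text \<open>
  Up to the factor \<open>n! / (t + 1/2)\<^bsup>n/2\<^esup>\<close>, the expression under the limit is the Gegenbauer
  polynomial of degree \<open>n\<close> and parameter \<open>t + 1/2\<close> at \<open>x / sqrt (t + 1/2)\<close>, so the theorem is the
  classical limit from Gegenbauer to Hermite polynomials. The proof does not pass through the
  polynomial form, which would require Euler's transformation of the hypergeometric series. It shows
  instead that the expression, \<open>g\<^sub>n(t)\<close> say, satisfies the Gegenbauer three-term recurrence
  \<open>g\<^sub>n\<^sub>+\<^sub>1 = (2 n + 2 t + 1) / (t + 1/2) * x * g\<^sub>n - n (n + 2 t) / (t + 1/2) * g\<^sub>n\<^sub>-\<^sub>1\<close>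
  with \<open>g\<^sub>0 = 1\<close>, for all large \<open>t\<close> (lemmas \<open>gegenbauer_scaled_rec\<close> and \<open>gegenbauer_scaled_0\<close>).
  As \<open>t\<close> tends to infinity, the coefficients tend to those of \<open>H\<^sub>n\<^sub>+\<^sub>1 = 2 x H\<^sub>n - 2 n H\<^sub>n\<^sub>-\<^sub>1\<close> (lemma \<open>hermite_rec\<close>),
  and the limit follows by induction on \<open>n\<close>.

  The recurrence for \<open>g\<^sub>n\<close> is the three-term recurrence in the degree of the Legendre functions,
  which holds for arbitrary real degree \<open>v\<close> and order \<open>-m\<close>. For the series
  \<open>F(-v, v+1; m+1; z)\<close> it can be read off coefficientwise (lemma \<open>hyp2F1_legendre_rec\<close>).
  The start \<open>g\<^sub>0 = 1\<close> is the binomial series \<open>F(-t, t+1; t+1; z) = (1-z)\<^sup>t\<close>.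
\<close>

section \<open>A three-term recurrence for the Gauss series\<close>

lemma hypergeo_nth:
  "fps_nth (fps_hypergeo [a, b] [c] 1) k =
     pochhammer a k * pochhammer b k / (pochhammer c k * fact k)" for a b c :: real
  by simp

lemma hyp2F1_sums:
  fixes a b c z :: real
  assumes "c > 0" and "\<bar>z\<bar> < 1"
  shows "(\<lambda>k. pochhammer a k * pochhammer b k / (pochhammer c k * fact k) * z ^ k)
           sums hyp2F1 a b c z"
proof -
  \<comment> \<open>Ratio test in the form that allows zero terms, since the series may terminate.\<close>
  let ?f = "\<lambda>k. pochhammer a k * pochhammer b k / (pochhammer c k * fact k) * z ^ k"
  let ?r = "\<lambda>k. (a + real k) * (b + real k) / ((c + real k) * (1 + real k))"
  have rec: "?f (Suc k) = ?r k * z * ?f k" for k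
    by (simp add: pochhammer_Suc mult_ac)
  have "?r \<longlonglongrightarrow> 1"
    by real_asymp
  then have "(\<lambda>k. \<bar>?r k * z\<bar>) \<longlonglongrightarrow> \<bar>1 * z\<bar>"
    by (intro tendsto_intros)
  moreover obtain q where q: "\<bar>z\<bar> < q" "q < 1"
    using assms(2) dense by blast
  ultimately have "eventually (\<lambda>k. \<bar>?r k * z\<bar> < q) sequentially"
    by (intro order_tendstoD(2)) auto
  then obtain N where N: "\<bar>?r k * z\<bar> < q" if "k \<ge> N" for k
    unfolding eventually_sequentially by blast
  have "summable ?f"
  proof (rule summable_ratio_test[of q N])
    fix k assume "k \<ge> N"
    then have "\<bar>?r k * z\<bar> * \<bar>?f k\<bar> \<le> q * \<bar>?f k\<bar>"
      by (intro mult_right_mono less_imp_le[OF N]) auto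
    then show "norm (?f (Suc k)) \<le> q * norm (?f k)"
      by (simp only: rec abs_mult real_norm_def)
  qed (use q in auto)
  then show ?thesis
    by (simp add: hyp2F1_def eval_fps_def hypergeo_nth summable_sums)
qed

text \<open>
  The identity behind \<open>hyp2F1_legendre_rec\<close>, for the coefficient of \<open>z\<^bsup>k+1\<^esup>\<close> with the denominator
  \<open>(m+1)\<^sub>k\<^sub>+\<^sub>1 (k+1)!\<close> cleared. Both shifted products are multiples of \<open>(-v)\<^sub>k (v+1)\<^sub>k\<close> by a
  quadratic factor, even where one of the single symbols is not, so that no value of \<open>v\<close>
  is exceptional.
\<close>

lemma hyp2F1_legendre_coeff:
  fixes v m :: real and k :: nat
  shows "(v + m + 1) * (pochhammer (- v - 1) (Suc k) * pochhammer (v + 2) (Suc k)) =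
     (2 * v + 1) * (pochhammer (- v) (Suc k) * pochhammer (v + 1) (Suc k)
        - 2 * (m + 1 + real k) * (1 + real k) * (pochhammer (- v) k * pochhammer (v + 1) k))
     - (v - m) * (pochhammer (1 - v) (Suc k) * pochhammer v (Suc k))"
proof -
  define A B where "A = pochhammer (- v) k" and "B = pochhammer (v + 1) k"
  have 1: "pochhammer (- v - 1) (Suc k) = (- v - 1) * A"
    using pochhammer_rec[of "- v - 1" k] by (simp add: A_def)
  have 2: "(v + 1) * pochhammer (v + 2) (Suc k) = B * (v + 1 + k) * (v + 2 + k)"
    using pochhammer_rec[of "v + 1" "Suc k"] by (simp add: B_def pochhammer_Suc algebra_simps)
  have 3: "- v * pochhammer (1 - v) (Suc k) = A * (- v + k) * (- v + 1 + k)"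
    using pochhammer_rec[of "- v" "Suc k"] by (simp add: A_def pochhammer_Suc algebra_simps)
  have 4: "pochhammer v (Suc k) = v * B"
    using pochhammer_rec[of v k] by (simp add: B_def)
  have 5: "pochhammer (- v) (Suc k) = A * (- v + k)" "pochhammer (v + 1) (Suc k) = B * (v + 1 + k)"
    by (simp_all add: A_def B_def pochhammer_Suc)
  have up: "pochhammer (- v - 1) (Suc k) * pochhammer (v + 2) (Suc k) =
      - (A * B * (v + 1 + k) * (v + 2 + k))"
    using 2 unfolding 1 by algebra
  have down: "pochhammer (1 - v) (Suc k) * pochhammer v (Suc k) =
      - (A * B * (- v + k) * (- v + 1 + k))"
    using 3 unfolding 4 by algebra
  show ?thesis
    unfolding up down 5 A_def[symmetric] B_def[symmetric] by algebra
qed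

text \<open>
  The recurrence in the degree \<open>v\<close> for Legendre functions of order \<open>-m\<close>, where \<open>1 - 2 z\<close> is
  the argument of the Legendre function. The coefficient \<open>v - m\<close> vanishes at \<open>v = m\<close>,
  which starts the recurrence from a single function.
\<close>

lemma hyp2F1_legendre_rec:
  fixes v m z :: real
  assumes "m > - 1" and "\<bar>z\<bar> < 1"
  shows "(v + m + 1) * hyp2F1 (- v - 1) (v + 2) (m + 1) z =
     (2 * v + 1) * (1 - 2 * z) * hyp2F1 (- v) (v + 1) (m + 1) z
     - (v - m) * hyp2F1 (1 - v) v (m + 1) z"
proof -
  define u where "u a b k = pochhammer a k * pochhammer b k / (pochhammer (m + 1) k * fact k) * z ^ k"
    for a b :: real and k
  have S: "u a b sums hyp2F1 a b (m + 1) z" for a b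
    using hyp2F1_sums[of "m + 1" z a b] assms by (simp add: u_def[abs_def])
  \<comment> \<open>The coefficients of \<open>z\<close> times the middle series: a shift of the index by one.\<close>
  define w where "w k = (case k of 0 \<Rightarrow> 0 | Suc j \<Rightarrow> z * u (- v) (v + 1) j)" for k
  have "(\<lambda>k. w (Suc k)) sums (z * hyp2F1 (- v) (v + 1) (m + 1) z)"
    unfolding w_def by (simp add: S sums_mult)
  then have W: "w sums (z * hyp2F1 (- v) (v + 1) (m + 1) z)"
    by (subst (asm) sums_Suc_iff) (simp add: w_def)
  have "(v + m + 1) * u (- v - 1) (v + 2) k =
      (2 * v + 1) * (u (- v) (v + 1) k - 2 * w k) - (v - m) * u (1 - v) v k" for k
  proof (cases k)
    case 0
    then show ?thesis by (simp add: u_def w_def algebra_simps)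
  next
    case (Suc j)
    define D where "D = z ^ Suc j / (pochhammer (m + 1) (Suc j) * fact (Suc j))"
    have pos: "pochhammer (m + 1) j > 0"
      using assms by (intro pochhammer_pos) auto
    have u': "u a b k = pochhammer a (Suc j) * pochhammer b (Suc j) * D" for a b
      by (simp add: u_def D_def Suc)
    have "m + 1 + real j > 0"
      using assms by linarith
    then have D: "(m + 1 + real j) * (1 + real j) * D = z * (z ^ j / (pochhammer (m + 1) j * fact j))"
      using pos by (simp add: D_def pochhammer_Suc divide_simps)
    have "w k = pochhammer (- v) j * pochhammer (v + 1) j *
        (z * (z ^ j / (pochhammer (m + 1) j * fact j)))"
      by (simp add: w_def u_def Suc)
    then have w': "w k = (m + 1 + real j) * (1 + real j) *
        (pochhammer (- v) j * pochhammer (v + 1) j) * D"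
      by (simp only: D[symmetric]) (simp only: mult_ac)
    show ?thesis
      using arg_cong[OF hyp2F1_legendre_coeff[of v m j], of "\<lambda>s. s * D"]
      unfolding u' w' by algebra
  qed
  then have "(\<lambda>k. (v + m + 1) * u (- v - 1) (v + 2) k) sums
      ((2 * v + 1) * (hyp2F1 (- v) (v + 1) (m + 1) z - 2 * (z * hyp2F1 (- v) (v + 1) (m + 1) z))
       - (v - m) * hyp2F1 (1 - v) v (m + 1) z)"
    by (simp only:) (intro sums_diff sums_mult S W)
  then have "(v + m + 1) * hyp2F1 (- v - 1) (v + 2) (m + 1) z =
      (2 * v + 1) * (hyp2F1 (- v) (v + 1) (m + 1) z - 2 * (z * hyp2F1 (- v) (v + 1) (m + 1) z))
       - (v - m) * hyp2F1 (1 - v) v (m + 1) z"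
    using sums_unique2 sums_mult[OF S] by blast
  then show ?thesis by (simp add: algebra_simps)
qed

lemma hyp2F1_cancel:
  fixes a c z :: real
  assumes "c > 0" and "\<bar>z\<bar> < 1"
  shows "hyp2F1 a c c z = (1 - z) powr (- a)"
proof -
  have "(\<lambda>k. pochhammer a k * pochhammer c k / (pochhammer c k * fact k) * z ^ k)
      = (\<lambda>k. (- a gchoose k) * (- z) ^ k)"
  proof
    fix k
    have "pochhammer c k > 0"
      using assms by (intro pochhammer_pos)
    then show "pochhammer a k * pochhammer c k / (pochhammer c k * fact k) * z ^ k
        = (- a gchoose k) * (- z) ^ k"
      by (simp add: gbinomial_pochhammer power_minus[of z])
  qed
  moreover have "(\<lambda>k. (- a gchoose k) * (- z) ^ k) sums (1 - z) powr (- a)"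
    using gen_binomial_real[of "- z" "- a"] assms by simp
  ultimately show ?thesis
    using hyp2F1_sums[OF assms] sums_unique2 by metis
qed

section \<open>The recurrence of the Hermite polynomials\<close>

lemma hermite_0: "hermite 0 x = 1"
  and hermite_1: "hermite 1 x = 2 * x"
  by (simp_all add: hermite_def)

lemma hermite_rec:
  "hermite (Suc (Suc n)) x = 2 * x * hermite (Suc n) x - 2 * real (Suc n) * hermite n x"
proof -
  \<comment> \<open>Extending the summands by zero makes the upper ends of the three sums immaterial once they
    are large enough. The factor \<open>n + 2\<close> is then split as \<open>(n + 2 - 2 j) + 2 j\<close>: the first part lowers the
    power of \<open>2 x\<close> in a summand, the second shifts \<open>j\<close>.\<close>
  define T where "T n j = (if 2 * j \<le> n then
      (- 1) ^ j * (2 * x) ^ (n - 2 * j) / (fact j * fact (n - 2 * j)) else 0)" for n j :: nat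
  have H: "hermite m x = fact m * (\<Sum>j\<le>N. T m j)" if "m div 2 \<le> N" for m N
  proof -
    have "(\<Sum>j\<le>m div 2. T m j) = (\<Sum>j\<le>N. T m j)"
      using that by (intro sum.mono_neutral_left) (auto simp: T_def)
    moreover have "(\<Sum>j\<le>m div 2. T m j) =
        (\<Sum>j\<le>m div 2. (- 1) ^ j * (2 * x) ^ (m - 2 * j) / (fact j * fact (m - 2 * j)))"
      by (intro sum.cong) (auto simp: T_def)
    ultimately show ?thesis by (simp add: hermite_def)
  qed
  have a: "(real (Suc (Suc n)) - 2 * real j) * T (Suc (Suc n)) j = 2 * x * T (Suc n) j" for j
  proof (cases "2 * j \<le> Suc n")
    case True
    then obtain d where d: "Suc n = 2 * j + d" using le_Suc_ex by blast
    then have e: "Suc (Suc n) - 2 * j = Suc d" "Suc n - 2 * j = d" "real (Suc (Suc n)) - 2 * real j = real (Suc d)"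
      by linarith+
    show ?thesis using True unfolding T_def e by (simp del: of_nat_Suc)
  next
    case False
    then show ?thesis by (cases "2 * j = Suc (Suc n)") (auto simp: T_def)
  qed
  have b: "real (Suc j) * T (Suc (Suc n)) (Suc j) = - T n j" for j
    by (auto simp: T_def simp del: of_nat_Suc)
  define N where "N = Suc n"
  have "real (Suc (Suc n)) * (\<Sum>j\<le>Suc N. T (Suc (Suc n)) j) =
      (\<Sum>j\<le>Suc N. 2 * x * T (Suc n) j) + 2 * (\<Sum>j\<le>Suc N. real j * T (Suc (Suc n)) j)"
    unfolding a[symmetric] by (simp only: sum_distrib_left sum.distrib[symmetric] algebra_simps) simp
  also have "(\<Sum>j\<le>Suc N. real j * T (Suc (Suc n)) j) = - (\<Sum>j\<le>N. T n j)"
    by (subst sum.atMost_Suc_shift) (simp add: b sum_negf del: of_nat_Suc)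
  finally have "real (Suc (Suc n)) * (\<Sum>j\<le>Suc N. T (Suc (Suc n)) j) =
      2 * x * (\<Sum>j\<le>Suc N. T (Suc n) j) - 2 * (\<Sum>j\<le>N. T n j)"
    by (simp only: sum_distrib_left[symmetric] mult_minus_right add_uminus_conv_diff)
  then have "fact (Suc n) * (real (Suc (Suc n)) * (\<Sum>j\<le>Suc N. T (Suc (Suc n)) j)) =
     fact (Suc n) * (2 * x * (\<Sum>j\<le>Suc N. T (Suc n) j) - 2 * (\<Sum>j\<le>N. T n j))"
    by simp
  moreover have "hermite (Suc (Suc n)) x = fact (Suc (Suc n)) * (\<Sum>j\<le>Suc N. T (Suc (Suc n)) j)"
    "hermite (Suc n) x = fact (Suc n) * (\<Sum>j\<le>Suc N. T (Suc n) j)"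
    "hermite n x = fact n * (\<Sum>j\<le>N. T n j)"
    by (intro H; simp add: N_def)+
  ultimately show ?thesis
    by (simp only: fact_Suc) (simp only: algebra_simps of_nat_mult)
qed

section \<open>Scaled Gegenbauer polynomials\<close>

text \<open>
  The expression of which the limit is taken. For \<open>t > 0\<close> and \<open>x\<^sup>2 < t + 1/2\<close> it equals
  \<open>n! C\<^sub>n(x / sqrt (t + 1/2)) / (t + 1/2)\<^bsup>n/2\<^esup>\<close>, with \<open>C\<^sub>n\<close> the Gegenbauer polynomial of parameter
  \<open>t + 1/2\<close>. The definition keeps the Ferrers function.
\<close>

definition gegenbauer_scaled :: "real \<Rightarrow> real \<Rightarrow> nat \<Rightarrow> real" where
  "gegenbauer_scaled x t n =
     2 powr t * Gamma (t + 1) * pochhammer (2 * t + 1) n /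
       ((t + 1 / 2) powr (real n / 2) * (1 - x\<^sup>2 / (t + 1 / 2)) powr (t / 2)) *
     ferrers_P (real n + t) t (x * (t + 1 / 2) powr (- 1 / 2))"

text \<open>
  With \<open>y = 1 - 2 z\<close> the argument of the Ferrers function, \<open>1 - x\<^sup>2 / (t + 1/2)\<close> is
  \<open>(1 - y) (1 + y)\<close>. The powers of \<open>1 - y\<close> cancel, and what remains of the elementary factors
  is \<open>((1 + y) / 2)\<^bsup>-t\<^esup> = (1 - z)\<^bsup>-t\<^esup>\<close>, independent of \<open>n\<close>.
\<close>

lemma gegenbauer_scaled_eq:
  fixes x t :: real
  assumes t: "t > 0" and x: "x\<^sup>2 < t + 1 / 2"
  defines "z \<equiv> (1 - x / sqrt (t + 1 / 2)) / 2"
  shows "\<bar>z\<bar> < 1"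
    and "gegenbauer_scaled x t n =
      pochhammer (2 * t + 1) n / sqrt (t + 1 / 2) ^ n * (1 - z) powr (- t) *
        hyp2F1 (- (real n + t)) (real n + t + 1) (t + 1) z"
proof -
  define y where "y = x / sqrt (t + 1 / 2)"
  have y2: "y\<^sup>2 = x\<^sup>2 / (t + 1 / 2)"
    using t by (simp add: y_def power_divide)
  have "y\<^sup>2 < 1"
    using t x by (simp add: y2)
  then have y: "- 1 < y" "y < 1"
    by (auto simp: abs_square_less_1)
  have zy: "z = (1 - y) / 2" "1 - z = (1 + y) / 2"
    by (simp_all add: z_def y_def field_simps)
  show "\<bar>z\<bar> < 1" using y by (simp add: zy)
  have arg: "x * (t + 1 / 2) powr (- 1 / 2) = y"
    using t by (simp add: y_def powr_minus powr_half_sqrt field_simps)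
  have "((t + 1 / 2) powr (1 / 2)) ^ n = (t + 1 / 2) powr (real n / 2)"
    using t by (simp add: powr_power)
  then have pw: "(t + 1 / 2) powr (real n / 2) = sqrt (t + 1 / 2) ^ n"
    using t by (simp add: powr_half_sqrt)
  have "1 - y\<^sup>2 = (1 - y) * (1 + y)" by (simp add: power2_eq_square algebra_simps)
  then have "(1 - y\<^sup>2) powr (t / 2) = (1 - y) powr (t / 2) * (1 + y) powr (t / 2)"
    using y by (simp only: powr_mult)
  then have "((1 - y) / (1 + y)) powr (t / 2) / (1 - y\<^sup>2) powr (t / 2)
      = (1 + y) powr (- (t / 2)) * (1 + y) powr (- (t / 2))"
    using y by (simp add: powr_divide powr_mult powr_minus field_simps)
  also have "\<dots> = (1 + y) powr (- t)"
    by (simp flip: powr_add)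
  finally have W: "2 powr t * (((1 - y) / (1 + y)) powr (t / 2) / (1 - y\<^sup>2) powr (t / 2))
      = (1 - z) powr (- t)"
    using y by (simp add: zy powr_divide powr_minus field_simps)
  have "Gamma (t + 1) > 0"
    using t by (intro Gamma_real_pos) simp
  then show "gegenbauer_scaled x t n =
      pochhammer (2 * t + 1) n / sqrt (t + 1 / 2) ^ n * (1 - z) powr (- t) *
        hyp2F1 (- (real n + t)) (real n + t + 1) (t + 1) z"
    unfolding gegenbauer_scaled_def ferrers_P_def arg pw y2[symmetric] zy(1)[symmetric] W[symmetric]
    by (simp add: add_ac mult_ac)
qed

lemma gegenbauer_scaled_0:
  assumes "t > 0" and "x\<^sup>2 < t + 1 / 2"
  shows "gegenbauer_scaled x t 0 = 1"
proof -
  define z where "z = (1 - x / sqrt (t + 1 / 2)) / 2"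
  have z: "\<bar>z\<bar> < 1" using gegenbauer_scaled_eq(1)[OF assms] by (simp add: z_def)
  have "gegenbauer_scaled x t 0 = (1 - z) powr (- t) * hyp2F1 (- t) (t + 1) (t + 1) z"
    by (simp add: gegenbauer_scaled_eq(2)[OF assms] z_def)
  also have "\<dots> = (1 - z) powr (- t) * (1 - z) powr t"
    using assms z by (simp add: hyp2F1_cancel)
  also have "\<dots> = 1" using z by (simp flip: powr_add)
  finally show ?thesis .
qed

text \<open>
  The truncated index \<open>n - 1\<close> is harmless at \<open>n = 0\<close>, where its coefficient is zero.
\<close>

lemma gegenbauer_scaled_rec:
  assumes "t > 0" and "x\<^sup>2 < t + 1 / 2"
  shows "gegenbauer_scaled x t (Suc n) =
    (2 * real n + 2 * t + 1) / (t + 1 / 2) * x * gegenbauer_scaled x t n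
    - real n * (real n + 2 * t) / (t + 1 / 2) * gegenbauer_scaled x t (n - 1)"
proof -
  define z where "z = (1 - x / sqrt (t + 1 / 2)) / 2"
  have z: "\<bar>z\<bar> < 1" using gegenbauer_scaled_eq(1)[OF assms] by (simp add: z_def)
  define s where "s = sqrt (t + 1 / 2)"
  define F where "F m = hyp2F1 (- (real m + t)) (real m + t + 1) (t + 1) z" for m
  define P where "P = pochhammer (2 * t + 1)"
  define K where "K = (1 - z) powr (- t)"
  have g: "gegenbauer_scaled x t m = P m / s ^ m * K * F m" for m
    by (simp add: gegenbauer_scaled_eq(2)[OF assms] F_def P_def K_def z_def s_def)
  have s: "s > 0" "s * s = t + 1 / 2" using assms by (simp_all add: s_def)
  have P: "P (Suc m) = (real m + 2 * t + 1) * P m" for m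
    by (simp add: P_def pochhammer_Suc algebra_simps)
  have zx: "1 - 2 * z = x / s" by (simp add: z_def s_def diff_divide_distrib)
  have up: "F (Suc n) = hyp2F1 (- (real n + t) - 1) (real n + t + 2) (t + 1) z"
    unfolding F_def by (rule arg_cong2[where f = "\<lambda>a b. hyp2F1 a b (t + 1) z"]) auto
  have down: "real n * F (n - 1) = real n * hyp2F1 (1 - (real n + t)) (real n + t) (t + 1) z"
  proof (cases n)
    case (Suc m)
    have "F m = hyp2F1 (1 - (real n + t)) (real n + t) (t + 1) z"
      unfolding F_def Suc by (rule arg_cong2[where f = "\<lambda>a b. hyp2F1 a b (t + 1) z"]) auto
    then show ?thesis by (simp add: Suc)
  qed simp
  have F: "(real n + 2 * t + 1) * F (Suc n) =
      (2 * (real n + t) + 1) * (x / s) * F n - real n * F (n - 1)"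
    using hyp2F1_legendre_rec[of t z "real n + t"] assms(1) z
    unfolding up down zx[symmetric] by (simp add: F_def add_ac)
  have "gegenbauer_scaled x t (Suc n) = P n * K / s ^ Suc n * ((real n + 2 * t + 1) * F (Suc n))"
    by (simp add: g P mult_ac)
  also have "\<dots> = (2 * real n + 2 * t + 1) / (s * s) * x * (P n / s ^ n * K * F n)
      - P n / s ^ Suc n * K * (real n * F (n - 1))"
    unfolding F using s(1) by (simp add: field_simps)
  also have "P n / s ^ Suc n * K * (real n * F (n - 1)) =
      real n * (real n + 2 * t) / (s * s) * (P (n - 1) / s ^ (n - 1) * K * F (n - 1))"
  proof (cases n)
    case (Suc m)
    then show ?thesis using s(1) P[of m] by (simp add: field_simps)
  qed simp
  finally show ?thesis
    by (simp only: s(2) g)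
qed

section \<open>The limit\<close>

lemma gegenbauer_scaled_tendsto:
  "((\<lambda>t. gegenbauer_scaled x t n) \<longlongrightarrow> hermite n x) at_top"
proof (induction n rule: less_induct)
  case (less n)
  have ev: "eventually (\<lambda>t. t > 0 \<and> x\<^sup>2 < t + 1 / 2) at_top"
    using eventually_gt_at_top[of "x\<^sup>2"] eventually_gt_at_top[of 0]
    by eventually_elim simp
  show ?case
  proof (cases n)
    case 0
    then show ?thesis
      by (auto intro!: tendsto_eventually eventually_mono[OF ev] simp: gegenbauer_scaled_0 hermite_0)
  next
    case (Suc m)
    have l1: "((\<lambda>t::real. (2 * real m + 2 * t + 1) / (t + 1 / 2)) \<longlongrightarrow> 2) at_top"
      by real_asymp
    have l2: "((\<lambda>t::real. real m * (real m + 2 * t) / (t + 1 / 2)) \<longlongrightarrow> 2 * real m) at_top"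
      by real_asymp
    have "((\<lambda>t. (2 * real m + 2 * t + 1) / (t + 1 / 2) * x * gegenbauer_scaled x t m
        - real m * (real m + 2 * t) / (t + 1 / 2) * gegenbauer_scaled x t (m - 1))
      \<longlongrightarrow> 2 * x * hermite m x - 2 * real m * hermite (m - 1) x) at_top"
      using less.IH Suc by (intro tendsto_intros l1 l2) auto
    also have "2 * x * hermite m x - 2 * real m * hermite (m - 1) x = hermite n x"
      using Suc hermite_rec hermite_0 hermite_1 by (cases m) auto
    finally show ?thesis
      unfolding Suc
      by (rule Lim_transform_eventually)
        (auto intro: eventually_mono[OF ev] simp: gegenbauer_scaled_rec)
  qed
qed

theorem corollary3p10:
  fixes n :: nat and x :: real
  assumes "x \<in> {-1<..<1}"
  shows "((\<lambda>t::real.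
            2 powr t * Gamma (t + 1) * pochhammer (2 * t + 1) n /
              ((t + 1 / 2) powr (real n / 2) * (1 - x\<^sup>2 / (t + 1 / 2)) powr (t / 2)) *
            ferrers_P (real n + t) t (x * (t + 1 / 2) powr (- 1 / 2)))
          \<longlongrightarrow> hermite n x) at_top"
  using gegenbauer_scaled_tendsto[of x n] unfolding gegenbauer_scaled_def .

end
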